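(* Let $A$ be a finite alphabet and let $S \subseteq A^*$ be a recurrent neutral set containing $A$ (i.e. every letter of $A$ belongs to $S$). Then for every finite $S$-maximal bifix code $X \subseteq S$ of $S$-degree $n$, one has $$\mathrm{Card}(X) = n(\mathrm{Card}(A)-\chi(S)) + \chi(S).$$
   Context: A set $S\subseteq A^*$ is factorial if it contains all factors of its elements. For $w\in S$: $L_S(w)=\{a\in A: aw\in S\}$, $R_S(w)=\{a\in A: wa\in S\}$, $E_S(w)=\{(a,b)\in A\times A: awb\in S\}$, $\ell_S(w)=\mathrm{Card}(L_S(w))$, $r_S(w)=\mathrm{Card}(R_S(w))$, $e_S(w)=\mathrm{Card}(E_S(w))$, and $m_S(w)=e_S(w)-\ell_S(w)-r_S(w)+1$. A word $w$ is neutral if $m_S(w)=0$; $S$ is a neutral set if it is factorial and every nonempty $w\in S$ is neutral. The characteristic of $S$ is $\chi(S)=1-m_S(\varepsilon)$, where $\varepsilon$ is the empty word. $S\neq\{\varepsilon\}$ is recurrent if it is factorial and for all $u,w\in S$ there is $v\in S$ with $uvw\in S$. A prefix (resp. suffix) code is a set of nonempty words containing no proper prefix (resp. proper suffix) of any of its elements; a bifix code is both. A bifix code $X\subseteq S$ is $S$-maximal if it is not properly contained in a bifix code $Y\subseteq S$. Given a bifix code $X$, let $Q$ be the set of words of $A^*$ having no suffix in $X$ and $P$ the set of words having no prefix in $X$; a parse of $w$ is a triple $(q,x,p)\in Q\times X^*\times P$ with $w=qxp$; $d_X(w)$ is the number of parses of $w$, and the $S$-degree of $X$ is the maximum of $d_X(w)$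 over $w\in S$. *)

theory Defs
  imports Main "HOL-Library.Sublist"
begin

text \<open>
  Words over the alphabet \<open>A\<close> are the elements of \<open>lists A\<close>; the empty word is \<open>[]\<close>.
\<close>

definition factorial :: "'a list set \<Rightarrow> bool" where
  "factorial S \<longleftrightarrow> (\<forall>w\<in>S. \<forall>u. sublist u w \<longrightarrow> u \<in> S)"

definition left_ext :: "'a set \<Rightarrow> 'a list set \<Rightarrow> 'a list \<Rightarrow> 'a set" where
  "left_ext A S w = {a \<in> A. a # w \<in> S}"

definition right_ext :: "'a set \<Rightarrow> 'a list set \<Rightarrow> 'a list \<Rightarrow> 'a set" where
  "right_ext A S w = {a \<in> A. w @ [a] \<in> S}"

definition two_sided_ext :: "'a set \<Rightarrow> 'a list set \<Rightarrow> 'a list \<Rightarrow> ('a \<times> 'a) set" where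
  "two_sided_ext A S w = {(a, b) \<in> A \<times> A. a # w @ [b] \<in> S}"

definition multiplicity :: "'a set \<Rightarrow> 'a list set \<Rightarrow> 'a list \<Rightarrow> int" where
  "multiplicity A S w =
     int (card (two_sided_ext A S w)) - int (card (left_ext A S w))
       - int (card (right_ext A S w)) + 1"

definition neutral_word :: "'a set \<Rightarrow> 'a list set \<Rightarrow> 'a list \<Rightarrow> bool" where
  "neutral_word A S w \<longleftrightarrow> multiplicity A S w = 0"

definition neutral_set :: "'a set \<Rightarrow> 'a list set \<Rightarrow> bool" where
  "neutral_set A S \<longleftrightarrow> factorial S \<and> (\<forall>w\<in>S. w \<noteq> [] \<longrightarrow> neutral_word A S w)"

definition characteristic :: "'a set \<Rightarrow> 'a list set \<Rightarrow> int" where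
  "characteristic A S = 1 - multiplicity A S []"

definition recurrent :: "'a list set \<Rightarrow> bool" where
  "recurrent S \<longleftrightarrow>
     S \<noteq> {[]} \<and> factorial S \<and> (\<forall>u\<in>S. \<forall>w\<in>S. \<exists>v\<in>S. u @ v @ w \<in> S)"

definition prefix_code :: "'a list set \<Rightarrow> bool" where
  "prefix_code X \<longleftrightarrow> [] \<notin> X \<and> (\<forall>x\<in>X. \<forall>y\<in>X. \<not> strict_prefix x y)"

definition suffix_code :: "'a list set \<Rightarrow> bool" where
  "suffix_code X \<longleftrightarrow> [] \<notin> X \<and> (\<forall>x\<in>X. \<forall>y\<in>X. \<not> strict_suffix x y)"

definition bifix_code :: "'a list set \<Rightarrow> bool" where
  "bifix_code X \<longleftrightarrow> prefix_code X \<and> suffix_code X"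

definition maximal_bifix_code :: "'a list set \<Rightarrow> 'a list set \<Rightarrow> bool" where
  "maximal_bifix_code S X \<longleftrightarrow>
     bifix_code X \<and> X \<subseteq> S \<and> \<not> (\<exists>Y. bifix_code Y \<and> Y \<subseteq> S \<and> X \<subset> Y)"

definition submonoid :: "'a list set \<Rightarrow> 'a list set" where
  "submonoid X = concat ` lists X"

definition no_suffix_in :: "'a set \<Rightarrow> 'a list set \<Rightarrow> 'a list set" where
  "no_suffix_in A X = {q \<in> lists A. \<not> (\<exists>x\<in>X. suffix x q)}"

definition no_prefix_in :: "'a set \<Rightarrow> 'a list set \<Rightarrow> 'a list set" where
  "no_prefix_in A X = {p \<in> lists A. \<not> (\<exists>x\<in>X. prefix x p)}"

definition parses :: "'a set \<Rightarrow> 'a list set \<Rightarrow> 'a list \<Rightarrow> ('a list \<times> 'a list \<times> 'a list) set" where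
  "parses A X w =
     {(q, x, p). q \<in> no_suffix_in A X \<and> x \<in> submonoid X \<and> p \<in> no_prefix_in A X \<and> w = q @ x @ p}"

definition parse_count :: "'a set \<Rightarrow> 'a list set \<Rightarrow> 'a list \<Rightarrow> nat" where
  "parse_count A X w = card (parses A X w)"

text \<open>
  \<open>Max\<close> is unspecified on an unbounded set of parse counts, so the value of \<open>S_degree\<close> is
  meaningful only when the parse counts on \<open>S\<close> are bounded. This is so for every finite
  \<open>S\<close>-maximal bifix code of a nonempty recurrent set \<open>S\<close>.
\<close>

definition S_degree :: "'a set \<Rightarrow> 'a list set \<Rightarrow> 'a list set \<Rightarrow> nat" where
  "S_degree A S X = Max (parse_count A X ` S)"

end

theory Submission imports Defs begin

text \<open>
  A finite \<open>S\<close>-maximal bifix code \<open>X\<close> of a recurrent set \<open>S\<close> is both prefix-complete and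
  suffix-complete in \<open>S\<close>, so the set \<open>P\<close> of words of \<open>S\<close> without prefix in \<open>X\<close> is the set of proper
  prefixes of \<open>X\<close>. Counting the nodes of the prefix tree of \<open>X\<close> gives
  \<open>Card X = 1 + (\<Sum>p\<in>P. r(p) - 1)\<close>. Put \<open>f(w) = r(w) - 1\<close> for \<open>w \<noteq> \<epsilon>\<close> and
  \<open>f(\<epsilon>) = Card A - \<chi>(S)\<close>. Neutrality says that \<open>f(w)\<close> is the sum of \<open>f(aw)\<close> over the left
  extensions \<open>aw\<close> of \<open>w\<close> in \<open>S\<close>. Hence, for large \<open>M\<close>, the sum of \<open>f\<close> over \<open>P\<close> equals the sum over
  the words \<open>w \<in> S\<close> of length \<open>M\<close> of \<open>f(w)\<close> times the number of suffixes of \<open>w\<close> in \<open>P\<close>. That number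
  is the number of parses of \<open>w\<close>, which is \<open>n\<close> as soon as \<open>w\<close> is not an internal factor of \<open>X\<close>. So
  the sum of \<open>f\<close> over \<open>P\<close> is \<open>n f(\<epsilon>)\<close>.
\<close>

section \<open>Parses\<close>

text \<open>For a suffix code, these are the last components of the parses of \<open>w\<close>, each
  occurring in exactly one parse.\<close>

definition suffix_parses :: "'a list set \<Rightarrow> 'a list \<Rightarrow> 'a list set" where
  "suffix_parses X w = {p. suffix p w \<and> \<not> (\<exists>x\<in>X. prefix x p)}"

definition prefix_parses :: "'a list set \<Rightarrow> 'a list \<Rightarrow> 'a list set" where
  "prefix_parses X w = {q. prefix q w \<and> \<not> (\<exists>x\<in>X. suffix x q)}"

section \<open>Factorizations over a code\<close>

lemma submonoid_Nil: "[] \<in> submonoid X"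
  unfolding submonoid_def by (rule image_eqI[of _ _ "[]"]) auto

lemma submonoid_append_left:
  assumes "x \<in> X" "y \<in> submonoid X"
  shows "x @ y \<in> submonoid X"
proof -
  obtain ys where "ys \<in> lists X" "y = concat ys"
    using assms(2) unfolding submonoid_def by auto
  then show ?thesis
    using assms(1) unfolding submonoid_def by (intro image_eqI[of _ _ "x # ys"]) auto
qed

lemma rev_concat_map_rev: "rev (concat xs) = concat (rev (map rev xs))"
  by (simp add: rev_concat rev_map)

lemma submonoid_rev: "x \<in> submonoid X \<Longrightarrow> rev x \<in> submonoid (rev ` X)"
  unfolding submonoid_def
  by (auto simp: rev_concat_map_rev intro!: imageI)

lemma submonoid_rev_iff: "rev x \<in> submonoid (rev ` X) \<longleftrightarrow> x \<in> submonoid X"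
  using submonoid_rev[of x X] submonoid_rev[of "rev x" "rev ` X"] by (auto simp: image_image)

text \<open>Code words are stripped from the left; each is nonempty, so this stops.\<close>

lemma prefix_factorization_exists:
  assumes "[] \<notin> X"
  shows "\<exists>x p. x \<in> submonoid X \<and> \<not> (\<exists>y\<in>X. prefix y p) \<and> v = x @ p"
proof (induction v rule: length_induct)
  case (1 v)
  show ?case
  proof (cases "\<exists>y\<in>X. prefix y v")
    case True
    then obtain y v' where y: "y \<in> X" "v = y @ v'"
      by (auto simp: prefix_def)
    then have "length v' < length v"
      using assms by (cases y) auto
    with 1 obtain x p where "x \<in> submonoid X" "\<not> (\<exists>y\<in>X. prefix y p)" "v' = x @ p"
      by blast
    then show ?thesis
      using y submonoid_append_left[of y X x]
      by (intro exI[of _ "y @ x"] exI[of _ p]) auto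
  next
    case False
    then show ?thesis
      using submonoid_Nil by (intro exI[of _ "[]"] exI[of _ v]) auto
  qed
qed

lemma prefix_code_eq:
  assumes "prefix_code X" "x \<in> X" "y \<in> X" "x @ u = y @ v"
  shows "x = y"
proof -
  have "prefix x y \<or> prefix y x"
    using assms(4) by (metis prefixI prefix_same_cases)
  then show ?thesis
    using assms(1-3) unfolding prefix_code_def by (auto simp: strict_prefix_def)
qed

text \<open>Code words that start the same word are equal, so the two factorizations agree factor by
  factor; if one ended first, its remainder would have a prefix in \<open>X\<close>.\<close>

lemma prefix_factorization_unique:
  assumes "prefix_code X"
    and "x \<in> submonoid X" "x' \<in> submonoid X"
    and "\<not> (\<exists>y\<in>X. prefix y p)" "\<not> (\<exists>y\<in>X. prefix y p')"
    and "x @ p = x' @ p'"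
  shows "p = p'"
proof -
  obtain xs ys where xs: "xs \<in> lists X" "x = concat xs" and ys: "ys \<in> lists X" "x' = concat ys"
    using assms(2,3) unfolding submonoid_def by auto
  have "xs \<in> lists X \<Longrightarrow> ys \<in> lists X \<Longrightarrow> concat xs @ p = concat ys @ p' \<Longrightarrow> p = p'"
  proof (induction xs arbitrary: ys)
    case Nil
    show ?case
    proof (cases ys)
      case Nil
      with Nil.prems show ?thesis by simp
    next
      case (Cons y zs)
      then have "y \<in> X" "prefix y p"
        using Nil.prems by auto
      then show ?thesis using assms(4) by blast
    qed
  next
    case (Cons z xs)
    show ?case
    proof (cases ys)
      case Nil
      then have "prefix z p'" using Cons.prems(3) by (metis append_Nil append_assoc concat.simps prefixI)
      moreover have "z \<in> X" using Cons.prems(1) by simp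
      ultimately show ?thesis using assms(5) by blast
    next
      case (Cons y zs)
      have eq: "z @ (concat xs @ p) = y @ (concat zs @ p')"
        using Cons.prems Cons by simp
      moreover have "z \<in> X" "y \<in> X"
        using Cons.prems Cons by auto
      ultimately have "z = y"
        using prefix_code_eq[OF assms(1)] by blast
      then show ?thesis
        using eq Cons.IH[of zs] Cons.prems Cons by auto
    qed
  qed
  then show ?thesis using assms(6) xs ys by simp
qed

text \<open>Reversal carries uniqueness over from prefix codes to suffix codes.\<close>

lemma prefix_code_rev: "suffix_code X \<Longrightarrow> prefix_code (rev ` X)"
  unfolding suffix_code_def prefix_code_def
  by (auto simp: strict_suffix_def strict_prefix_def suffix_to_prefix)

lemma suffix_factorization_exists:
  assumes "[] \<notin> X"
  shows "\<exists>q x. x \<in> submonoid X \<and> \<not> (\<exists>y\<in>X. suffix y q) \<and> v = q @ x"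
proof -
  have "[] \<notin> rev ` X" using assms by auto
  then obtain x p where "x \<in> submonoid (rev ` X)" "\<not> (\<exists>y\<in>rev ` X. prefix y p)" "rev v = x @ p"
    using prefix_factorization_exists[of "rev ` X" "rev v"] by blast
  then show ?thesis
    using submonoid_rev_iff[of "rev x" X]
    by (intro exI[of _ "rev p"] exI[of _ "rev x"])
      (auto simp: suffix_to_prefix rev_swap)
qed

lemma suffix_factorization_unique:
  assumes "suffix_code X"
    and "x \<in> submonoid X" "x' \<in> submonoid X"
    and "\<not> (\<exists>y\<in>X. suffix y q)" "\<not> (\<exists>y\<in>X. suffix y q')"
    and "q @ x = q' @ x'"
  shows "q = q'"
proof -
  have "rev x @ rev q = rev x' @ rev q'"
    using assms(6) by (metis rev_append)
  then have "rev q = rev q'"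
    using prefix_factorization_unique[OF prefix_code_rev[OF assms(1)],
        of "rev x" "rev x'" "rev q" "rev q'"] assms(2-5)
    by (auto simp: submonoid_rev_iff suffix_to_prefix)
  then show ?thesis by simp
qed

text \<open>A parse is determined by its first component \<open>q\<close>, because what follows
  \<open>q\<close> factors uniquely; every admissible \<open>q\<close> occurs, because a
  factorization always exists.\<close>

lemma parse_count_eq_prefix_parses:
  assumes "prefix_code X" "w \<in> lists A"
  shows "parse_count A X w = card (prefix_parses X w)"
proof -
  have nil: "[] \<notin> X" using assms(1) unfolding prefix_code_def by blast
  have "inj_on fst (parses A X w)"
  proof (rule inj_onI)
    fix s t assume st: "s \<in> parses A X w" "t \<in> parses A X w" "fst s = fst t"
    obtain q x p x' p' where [simp]: "s = (q, x, p)" "t = (q, x', p')"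
      using st(3) by (cases s; cases t) auto
    have "p = p'"
      using st(1,2) by (intro prefix_factorization_unique[OF assms(1), of x x' p p'])
        (auto simp: parses_def no_prefix_in_def)
    then show "s = t" using st(1,2) by (auto simp: parses_def)
  qed
  moreover have "fst ` parses A X w = prefix_parses X w"
  proof (intro equalityI subsetI)
    fix q assume "q \<in> fst ` parses A X w"
    then show "q \<in> prefix_parses X w"
      by (auto simp: parses_def prefix_parses_def no_suffix_in_def)
  next
    fix q assume q: "q \<in> prefix_parses X w"
    then obtain v where v: "w = q @ v" by (auto simp: prefix_parses_def prefix_def)
    obtain x p where "x \<in> submonoid X" "\<not> (\<exists>y\<in>X. prefix y p)" "v = x @ p"
      using prefix_factorization_exists[OF nil] by blast
    then have "(q, x, p) \<in> parses A X w"
      using q v assms(2) by (auto simp: parses_def prefix_parses_def no_suffix_in_def no_prefix_in_def)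
    then show "q \<in> fst ` parses A X w" by force
  qed
  ultimately show ?thesis
    unfolding parse_count_def by (metis card_image)
qed

lemma parse_count_eq_suffix_parses:
  assumes "suffix_code X" "w \<in> lists A"
  shows "parse_count A X w = card (suffix_parses X w)"
proof -
  let ?f = "\<lambda>(q, x, p). p"
  have nil: "[] \<notin> X" using assms(1) unfolding suffix_code_def by blast
  have "inj_on ?f (parses A X w)"
  proof (rule inj_onI)
    fix s t assume st: "s \<in> parses A X w" "t \<in> parses A X w" "?f s = ?f t"
    obtain q x p q' x' where [simp]: "s = (q, x, p)" "t = (q', x', p)"
      using st(3) by (cases s; cases t) auto
    have "q @ x = q' @ x'"
      using st(1,2) by (auto simp: parses_def simp flip: append_assoc)
    then have "q = q'"
      using st(1,2) by (intro suffix_factorization_unique[OF assms(1), of x x' q q'])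
        (auto simp: parses_def no_suffix_in_def)
    then show "s = t" using st(1,2) by (auto simp: parses_def)
  qed
  moreover have "?f ` parses A X w = suffix_parses X w"
  proof (intro equalityI subsetI)
    fix p assume "p \<in> ?f ` parses A X w"
    then show "p \<in> suffix_parses X w"
      by (auto simp: parses_def suffix_parses_def no_prefix_in_def suffix_def)
  next
    fix p assume p: "p \<in> suffix_parses X w"
    then obtain v where v: "w = v @ p" by (auto simp: suffix_parses_def suffix_def)
    obtain q x where "x \<in> submonoid X" "\<not> (\<exists>y\<in>X. suffix y q)" "v = q @ x"
      using suffix_factorization_exists[OF nil] by blast
    then have "(q, x, p) \<in> parses A X w"
      using p v assms(2) by (auto simp: parses_def suffix_parses_def no_suffix_in_def no_prefix_in_def)
    then show "p \<in> ?f ` parses A X w" by force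
  qed
  ultimately show ?thesis
    unfolding parse_count_def by (metis card_image)
qed

section \<open>Growth of parse counts under extension by a letter\<close>

lemma finite_suffix_parses: "finite (suffix_parses X w)"
  by (rule finite_subset[of _ "set (suffixes w)"]) (auto simp: suffix_parses_def)

lemma finite_prefix_parses: "finite (prefix_parses X w)"
  by (rule finite_subset[of _ "set (prefixes w)"]) (auto simp: prefix_parses_def)

text \<open>The only new suffix is \<open>a # w\<close> itself. Hence a count that stays constant
  under extension produces words of \<open>X\<close>.\<close>

lemma card_suffix_parses_Cons:
  "card (suffix_parses X (a # w)) =
     card (suffix_parses X w) + (if \<exists>x\<in>X. prefix x (a # w) then 0 else 1)"
proof -
  have "suffix_parses X (a # w) =
      (if \<exists>x\<in>X. prefix x (a # w) then suffix_parses X w else insert (a # w) (suffix_parses X w))"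
    by (auto simp: suffix_parses_def suffix_Cons)
  moreover have "a # w \<notin> suffix_parses X w"
    by (auto simp: suffix_parses_def dest: suffix_length_le)
  ultimately show ?thesis using finite_suffix_parses[of X w] by simp
qed

lemma card_prefix_parses_snoc:
  "card (prefix_parses X (w @ [a])) =
     card (prefix_parses X w) + (if \<exists>x\<in>X. suffix x (w @ [a]) then 0 else 1)"
proof -
  have "prefix_parses X (w @ [a]) =
      (if \<exists>x\<in>X. suffix x (w @ [a]) then prefix_parses X w else insert (w @ [a]) (prefix_parses X w))"
    by (auto simp: prefix_parses_def)
  moreover have "w @ [a] \<notin> prefix_parses X w"
    by (auto simp: prefix_parses_def dest: prefix_length_le)
  ultimately show ?thesis using finite_prefix_parses[of X w] by auto
qed

lemma card_suffix_parses_mono: "card (suffix_parses X w) \<le> card (suffix_parses X (u @ w))"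
  by (induction u) (auto simp: card_suffix_parses_Cons)

lemma card_prefix_parses_mono: "card (prefix_parses X w) \<le> card (prefix_parses X (w @ u))"
  by (induction u rule: rev_induct) (auto simp: card_prefix_parses_snoc simp flip: append_assoc)

text \<open>Both sides count the parses of \<open>w\<close>. This links extension to the left, which
  governs the left side, with extension to the right, which governs the right side.\<close>

lemma card_suffix_parses_eq_prefix_parses:
  assumes "bifix_code X"
  shows "card (suffix_parses X w) = card (prefix_parses X w)"
  using parse_count_eq_prefix_parses[of X w UNIV] parse_count_eq_suffix_parses[of X w UNIV] assms
  unfolding bifix_code_def by simp

section \<open>Completeness of maximal bifix codes\<close>

text \<open>For a nonempty prefix code contained in \<open>S\<close>, this is maximality among the
  prefix codes contained in \<open>S\<close>.\<close>

definition prefix_complete :: "'a list set \<Rightarrow> 'a list set \<Rightarrow> bool" where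
  "prefix_complete S X \<longleftrightarrow> (\<forall>w\<in>S. \<exists>x\<in>X. prefix x w \<or> prefix w x)"

definition suffix_complete :: "'a list set \<Rightarrow> 'a list set \<Rightarrow> bool" where
  "suffix_complete S X \<longleftrightarrow> (\<forall>w\<in>S. \<exists>x\<in>X. suffix x w \<or> suffix w x)"

lemma factorial_appendD:
  assumes "factorial S" "u @ v @ w \<in> S"
  shows "v \<in> S"
  using assms unfolding factorial_def by (meson sublist_appendI)

lemma factorial_appendD1: "factorial S \<Longrightarrow> u @ v \<in> S \<Longrightarrow> u \<in> S"
  using factorial_appendD[of S "[]" u v] by simp

lemma factorial_appendD2: "factorial S \<Longrightarrow> u @ v \<in> S \<Longrightarrow> v \<in> S"
  using factorial_appendD[of S u v "[]"] by simp

lemma finite_proper_prefixes: "finite X \<Longrightarrow> finite {p. \<exists>x\<in>X. strict_prefix p x}"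
  by (rule finite_subset[of _ "\<Union>x\<in>X. set (prefixes x)"]) auto

lemma finite_proper_suffixes: "finite X \<Longrightarrow> finite {p. \<exists>x\<in>X. strict_suffix p x}"
  by (rule finite_subset[of _ "\<Union>x\<in>X. set (suffixes x)"]) auto

text \<open>A word comparable with a word of \<open>X\<close> but without prefix in \<open>X\<close>
  must be a proper prefix. For finite \<open>X\<close> this bounds the parse counts uniformly on
  \<open>S\<close>.\<close>

lemma suffix_parses_subset:
  assumes "factorial S" "prefix_complete S X" "w \<in> S"
  shows "suffix_parses X w \<subseteq> {p. \<exists>x\<in>X. strict_prefix p x}"
proof
  fix p assume p: "p \<in> suffix_parses X w"
  then have "p \<in> S"
    using assms(1,3) factorial_appendD2 by (auto simp: suffix_parses_def suffix_def)
  then show "p \<in> {p. \<exists>x\<in>X. strict_prefix p x}"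
    using p assms(2) by (auto simp: suffix_parses_def prefix_complete_def strict_prefix_def)
qed

lemma prefix_parses_subset:
  assumes "factorial S" "suffix_complete S X" "w \<in> S"
  shows "prefix_parses X w \<subseteq> {q. \<exists>x\<in>X. strict_suffix q x}"
proof
  fix q assume q: "q \<in> prefix_parses X w"
  then have "q \<in> S"
    using assms(1,3) factorial_appendD1 by (auto simp: prefix_parses_def prefix_def)
  then show "q \<in> {q. \<exists>x\<in>X. strict_suffix q x}"
    using q assms(2) by (auto simp: prefix_parses_def suffix_complete_def strict_suffix_def)
qed

lemma bounded_attains_Max:
  fixes d :: "'b \<Rightarrow> nat"
  assumes "S \<noteq> {}" "\<And>w. w \<in> S \<Longrightarrow> d w \<le> N"
  obtains z where "z \<in> S" "d z = Max (d ` S)" "\<And>w. w \<in> S \<Longrightarrow> d w \<le> d z"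
proof -
  have fin: "finite (d ` S)"
    using assms(2) by (intro finite_subset[of "d ` S" "{..N}"]) auto
  then have "Max (d ` S) \<in> d ` S" using assms(1) by simp
  then obtain z where "z \<in> S" "d z = Max (d ` S)" by auto
  with fin show ?thesis using that[of z] by auto
qed

text \<open>
  Prefix-completeness bounds the parse counts on \<open>S\<close>. If \<open>z\<close> attains the maximum, then extending
  \<open>z\<close> to the right creates no new parse, so every proper extension of \<open>z\<close> in \<open>S\<close> has a suffix
  in \<open>X\<close>.
\<close>

lemma prefix_complete_imp_suffix_complete:
  assumes "recurrent S" "bifix_code X" "finite X" "prefix_complete S X"
  shows "suffix_complete S X"
proof (cases "S = {}")
  case True
  then show ?thesis by (simp add: suffix_complete_def)
next
  case False
  have fac: "factorial S" using assms(1) by (simp add: recurrent_def)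
  note eq = card_suffix_parses_eq_prefix_parses[OF assms(2)]
  \<comment> \<open>Prefix-completeness bounds \<open>suffix_parses\<close>; \<open>eq\<close> moves
    the bound to \<open>prefix_parses\<close>, whose growth to the right is easy to follow.\<close>
  have "card (prefix_parses X w) \<le> card {p. \<exists>x\<in>X. strict_prefix p x}" if "w \<in> S" for w
    unfolding eq[symmetric]
    using suffix_parses_subset[OF fac assms(4) that] finite_proper_prefixes[OF assms(3)]
    by (rule card_mono[rotated])
  with False obtain z where z: "z \<in> S"
      "\<And>w. w \<in> S \<Longrightarrow> card (prefix_parses X w) \<le> card (prefix_parses X z)"
    by (rule bounded_attains_Max[of S "\<lambda>w. card (prefix_parses X w)"]) blast+
  show ?thesis
    unfolding suffix_complete_def
  proof
    fix v assume v: "v \<in> S"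
    show "\<exists>x\<in>X. suffix x v \<or> suffix v x"
    proof (cases v rule: rev_cases)
      case Nil
      then show ?thesis using v assms(4) by (auto simp: prefix_complete_def)
    next
      case (snoc v' a)
      \<comment> \<open>Recurrence makes \<open>v\<close> the end of a word extending
        \<open>z\<close>, so a suffix in \<open>X\<close> of that word is comparable with
        \<open>v\<close>.\<close>
      obtain t where t: "z @ t @ v \<in> S" using assms(1) z v unfolding recurrent_def by blast
      have "\<exists>x\<in>X. suffix x ((z @ t @ v') @ [a])"
        using card_prefix_parses_snoc[of X "z @ t @ v'" a] z(2)[OF t]
          card_prefix_parses_mono[of X z "t @ v'"] snoc by (auto split: if_splits)
      then obtain x where "x \<in> X" "suffix x (z @ t @ v)" using snoc by auto
      moreover have "suffix v (z @ t @ v)" by (metis append_assoc suffixI)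
      ultimately show ?thesis by (meson suffix_same_cases)
    qed
  qed
qed

text \<open>Mirror image: a word \<open>z\<close> with the most parses is extended to the left, and
  every proper extension in \<open>S\<close> must begin with a word of \<open>X\<close>.\<close>

lemma suffix_complete_imp_prefix_complete:
  assumes "recurrent S" "bifix_code X" "finite X" "suffix_complete S X"
  shows "prefix_complete S X"
proof (cases "S = {}")
  case True
  then show ?thesis by (simp add: prefix_complete_def)
next
  case False
  have fac: "factorial S" using assms(1) by (simp add: recurrent_def)
  note eq = card_suffix_parses_eq_prefix_parses[OF assms(2)]
  have "card (suffix_parses X w) \<le> card {p. \<exists>x\<in>X. strict_suffix p x}" if "w \<in> S" for w
    unfolding eq
    using prefix_parses_subset[OF fac assms(4) that] finite_proper_suffixes[OF assms(3)]
    by (rule card_mono[rotated])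
  with False obtain z where z: "z \<in> S"
      "\<And>w. w \<in> S \<Longrightarrow> card (suffix_parses X w) \<le> card (suffix_parses X z)"
    by (rule bounded_attains_Max[of S "\<lambda>w. card (suffix_parses X w)"]) blast+
  show ?thesis
    unfolding prefix_complete_def
  proof
    fix v assume v: "v \<in> S"
    show "\<exists>x\<in>X. prefix x v \<or> prefix v x"
    proof (cases v)
      case Nil
      then show ?thesis using v assms(4) by (auto simp: suffix_complete_def)
    next
      case (Cons a v')
      obtain t where t: "v @ t @ z \<in> S" using assms(1) z v unfolding recurrent_def by blast
      have "\<exists>x\<in>X. prefix x (a # (v' @ t @ z))"
        using card_suffix_parses_Cons[of X a "v' @ t @ z"] z(2)[OF t]
          card_suffix_parses_mono[of X z "v' @ t"] Cons by (auto split: if_splits)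
      then obtain x where "x \<in> X" "prefix x (v @ t @ z)" using Cons by auto
      moreover have "prefix v (v @ t @ z)" by simp
      ultimately show ?thesis by (meson prefix_same_cases)
    qed
  qed
qed

text \<open>If both properties failed, a word incomparable with \<open>X\<close> at the front and
  one incomparable at the back could be joined inside \<open>S\<close>, and the result added to
  \<open>X\<close>. So one holds, and it implies the other.\<close>

lemma maximal_bifix_code_complete:
  assumes "recurrent S" "finite X" "maximal_bifix_code S X"
  shows "prefix_complete S X" "suffix_complete S X"
proof -
  have bif: "bifix_code X" and sub: "X \<subseteq> S"
    and max: "\<And>Y. bifix_code Y \<Longrightarrow> Y \<subseteq> S \<Longrightarrow> \<not> X \<subset> Y"
    using assms(3) unfolding maximal_bifix_code_def by auto
  have "prefix_complete S X \<or> suffix_complete S X"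
  proof (rule ccontr)
    assume "\<not> ?thesis"
    then obtain u v where u: "u \<in> S" "\<And>x. x \<in> X \<Longrightarrow> \<not> prefix x u \<and> \<not> prefix u x"
      and v: "v \<in> S" "\<And>x. x \<in> X \<Longrightarrow> \<not> suffix x v \<and> \<not> suffix v x"
      by (auto simp: prefix_complete_def suffix_complete_def)
    obtain t where t: "u @ t @ v \<in> S" using assms(1) u v unfolding recurrent_def by blast
    define y where "y = u @ t @ v"
    have pre: "\<not> prefix x y \<and> \<not> prefix y x" if "x \<in> X" for x
      using u(2)[OF that] unfolding y_def
      by (metis append_prefixD prefix_same_cases prefixI)
    have suf: "\<not> suffix x y \<and> \<not> suffix y x" if "x \<in> X" for x
      using v(2)[OF that] unfolding y_def
      by (metis append_assoc suffix_appendD suffix_same_cases suffixI)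
    have "y \<notin> X" using pre by blast
    \<comment> \<open>The empty word is a prefix of every word, so an empty \<open>y\<close> forces
      \<open>X\<close> to be empty; a nonempty word of \<open>S\<close> then gives a larger bifix
      code.\<close>
    have "y \<noteq> []"
    proof
      assume "y = []"
      then have "X = {}" using pre by auto
      have "\<exists>w\<in>S. w \<noteq> []" using assms(1) u(1) unfolding recurrent_def by auto
      then obtain w where "w \<in> S" "w \<noteq> []" by blast
      moreover have "bifix_code {w}"
        using \<open>w \<noteq> []\<close> by (auto simp: bifix_code_def prefix_code_def suffix_code_def)
      ultimately show False using max[of "{w}"] \<open>X = {}\<close> by auto
    qed
    then have "bifix_code (insert y X)"
      using bif pre suf unfolding bifix_code_def prefix_code_def suffix_code_def
      by (auto simp: strict_prefix_def strict_suffix_def)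
    moreover have "insert y X \<subseteq> S" using sub t y_def by simp
    ultimately show False using max[of "insert y X"] \<open>y \<notin> X\<close> by auto
  qed
  then show "prefix_complete S X" "suffix_complete S X"
    using prefix_complete_imp_suffix_complete[OF assms(1) bif assms(2)]
      suffix_complete_imp_prefix_complete[OF assms(1) bif assms(2)] by auto
qed

text \<open>A longer word of \<open>S\<close> starting with \<open>w\<close> exceeds all code words
  in length, so it ends in one and gains no parse. Extending \<open>w\<close> up to a word with the
  most parses shows that \<open>w\<close> already has that many.\<close>

lemma parse_count_long_word:
  assumes "recurrent S" "S \<subseteq> lists A" "bifix_code X" "finite X"
    and pc: "prefix_complete S X" and sc: "suffix_complete S X"
    and w: "w \<in> S" "\<And>x. x \<in> X \<Longrightarrow> length x \<le> length w"
  shows "card (suffix_parses X w) = S_degree A S X"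
proof -
  have fac: "factorial S" using assms(1) by (simp add: recurrent_def)
  have "suffix_code X" using assms(3) by (simp add: bifix_code_def)
  note eq = card_suffix_parses_eq_prefix_parses[OF assms(3)]
  have parse: "parse_count A X v = card (suffix_parses X v)" if "v \<in> S" for v
    using parse_count_eq_suffix_parses[OF \<open>suffix_code X\<close>] assms(2) that by blast
  have bound: "parse_count A X v \<le> card {p. \<exists>x\<in>X. strict_prefix p x}" if "v \<in> S" for v
    unfolding parse[OF that]
    using suffix_parses_subset[OF fac pc that] finite_proper_prefixes[OF assms(4)]
    by (rule card_mono[rotated])
  have "S \<noteq> {}" using w by auto
  then obtain z where z: "z \<in> S" "parse_count A X z = S_degree A S X"
      "\<And>v. v \<in> S \<Longrightarrow> parse_count A X v \<le> parse_count A X z"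
    unfolding S_degree_def using bound
    by (rule bounded_attains_Max[of S "parse_count A X"]) blast+
  have ext: "w @ u \<in> S \<Longrightarrow> card (prefix_parses X (w @ u)) = card (prefix_parses X w)" for u
  proof (induction u rule: rev_induct)
    case Nil
    then show ?case by simp
  next
    case (snoc a u)
    have "(w @ u) @ [a] \<in> S" using snoc.prems by simp
    then have "w @ u \<in> S" by (rule factorial_appendD1[OF fac])
    obtain x where x: "x \<in> X" "suffix x (w @ u @ [a]) \<or> suffix (w @ u @ [a]) x"
      using sc snoc.prems unfolding suffix_complete_def by blast
    then have "suffix x ((w @ u) @ [a])"
      using w(2)[OF x(1)] by (auto dest: suffix_length_le)
    then have "card (prefix_parses X ((w @ u) @ [a])) = card (prefix_parses X (w @ u))"
      using x(1) card_prefix_parses_snoc[of X "w @ u" a] by auto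
    then show ?case using snoc.IH[OF \<open>w @ u \<in> S\<close>] by simp
  qed
  obtain t where t: "w @ t @ z \<in> S" using assms(1) z w unfolding recurrent_def by blast
  have "card (suffix_parses X z) \<le> card (suffix_parses X (w @ t @ z))"
    using card_suffix_parses_mono[of X z "w @ t"] by simp
  also have "\<dots> = card (suffix_parses X w)" using ext[OF t] by (simp add: eq)
  finally show ?thesis using z w parse by (metis le_antisym)
qed

section \<open>The prefix tree of a prefix code\<close>

text \<open>In the tree with inner nodes \<open>P\<close> and leaves \<open>X\<close>, completeness
  makes \<open>right_ext A S p\<close> label all edges below \<open>p\<close>. Edges correspond to
  nodes other than the root, of which there are \<open>card P + card X - 1\<close>.\<close>

lemma card_prefix_tree:
  assumes "finite A" "S \<subseteq> lists A" "factorial S" "finite X" "X \<noteq> {}" "X \<subseteq> S" "prefix_code X"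
    and "prefix_complete S X"
  defines "P \<equiv> {p. \<exists>x\<in>X. strict_prefix p x}"
  shows "int (card X) = 1 + (\<Sum>p\<in>P. int (card (right_ext A S p)) - 1)"
proof -
  have "finite P" unfolding P_def using finite_proper_prefixes[OF assms(4)] .
  have "[] \<in> P" using assms(5,7) unfolding P_def prefix_code_def by (auto simp: strict_prefix_def)
  have disj: "P \<inter> X = {}" using assms(7) unfolding P_def prefix_code_def by auto
  have finR: "finite (right_ext A S p)" for p using assms(1) by (simp add: right_ext_def)
  have "(\<lambda>(p, a). p @ [a]) ` (SIGMA p:P. right_ext A S p) = P \<union> X - {[]}"
  proof (intro equalityI subsetI)
    fix w assume "w \<in> (\<lambda>(p, a). p @ [a]) ` (SIGMA p:P. right_ext A S p)"
    then obtain p a where pa: "w = p @ [a]" "p \<in> P" "w \<in> S" by (auto simp: right_ext_def)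
    obtain x where x: "x \<in> X" "strict_prefix p x" using pa(2) unfolding P_def by blast
    obtain y where y: "y \<in> X" "prefix y w \<or> prefix w y"
      using assms(8) pa(3) unfolding prefix_complete_def by blast
    \<comment> \<open>Otherwise \<open>y\<close> would be a proper prefix of the code word
      \<open>x\<close>.\<close>
    have "\<not> prefix y p"
      using x y assms(7) unfolding prefix_code_def by (meson prefix_order.le_less_trans)
    then have "prefix w y" using y(2) pa(1) by auto
    then show "w \<in> P \<union> X - {[]}"
      using y(1) pa(1) unfolding P_def by (auto simp: strict_prefix_def)
  next
    fix w assume w: "w \<in> P \<union> X - {[]}"
    then obtain x where x: "x \<in> X" "prefix w x" unfolding P_def by (auto simp: strict_prefix_def)
    obtain p a where pa: "w = p @ [a]" using w by (cases w rule: rev_cases) auto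
    have "w \<in> S" using x assms(3,6) factorial_appendD1 by (auto simp: prefix_def)
    moreover have "p \<in> P"
      using x pa unfolding P_def by (auto simp: strict_prefix_def prefix_def)
    ultimately have "(p, a) \<in> (SIGMA p:P. right_ext A S p)"
      using pa assms(2) by (auto simp: right_ext_def)
    then show "w \<in> (\<lambda>(p, a). p @ [a]) ` (SIGMA p:P. right_ext A S p)"
      using pa by force
  qed
  moreover have "inj_on (\<lambda>(p, a). p @ [a]) (SIGMA p:P. right_ext A S p)"
    by (auto simp: inj_on_def)
  ultimately have "card (SIGMA p:P. right_ext A S p) = card (P \<union> X - {[]})"
    by (metis card_image)
  also have "\<dots> = card P + card X - 1"
    using \<open>[] \<in> P\<close> \<open>finite P\<close> assms(4) disj by (simp add: card_Un_disjoint)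
  finally have "(\<Sum>p\<in>P. card (right_ext A S p)) = card P + card X - 1"
    using \<open>finite P\<close> finR by simp
  \<comment> \<open>Positivity makes the truncated subtraction exact when passing to
    integers.\<close>
  moreover have "card P > 0" using \<open>[] \<in> P\<close> \<open>finite P\<close> by (auto simp: card_gt_0_iff)
  ultimately have "(\<Sum>p\<in>P. int (card (right_ext A S p))) = int (card P) + int (card X) - 1"
    by (simp flip: of_nat_sum)
  then show ?thesis by (simp add: sum_subtractf)
qed

section \<open>Left-harmonic functions\<close>

text \<open>The additivity of a left probability distribution on \<open>S\<close>, unnormalized and
  with negative values allowed.\<close>

definition left_harmonic :: "'a set \<Rightarrow> 'a list set \<Rightarrow> ('a list \<Rightarrow> int) \<Rightarrow> bool" where
  "left_harmonic A S f \<longleftrightarrow> (\<forall>w\<in>S. f w = (\<Sum>a\<in>left_ext A S w. f (a # w)))"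

lemma finite_words_of_length: "finite A \<Longrightarrow> S \<subseteq> lists A \<Longrightarrow> finite {w \<in> S. length w = M}"
  by (rule finite_subset[OF _ finite_lists_length_eq[of A M]]) auto

text \<open>Harmonicity is iterated \<open>k\<close> times; \<open>k\<close> varies so that words of
  different lengths can be compared at one common length.\<close>

lemma left_harmonic_sum:
  assumes "finite A" "S \<subseteq> lists A" "factorial S" "left_harmonic A S f" "p \<in> S"
  shows "f p = (\<Sum>w\<in>{w\<in>S. suffix p w \<and> length w = length p + k}. f w)"
proof (induction k)
  case 0
  have "{w\<in>S. suffix p w \<and> length w = length p + 0} = {p}"
    using assms(5) by (auto simp: suffix_def)
  then show ?case by simp
next
  case (Suc k)
  let ?W = "\<lambda>k. {w\<in>S. suffix p w \<and> length w = length p + k}"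
  let ?g = "\<lambda>(w, a). a # w"
  have fin: "finite (?W k)"
    by (rule finite_subset[OF _ finite_words_of_length[OF assms(1,2), of "length p + k"]]) auto
  have "?g ` (SIGMA w:?W k. left_ext A S w) = ?W (Suc k)"
  proof (intro equalityI subsetI)
    fix v assume "v \<in> ?W (Suc k)"
    then have v: "v \<in> S" "suffix p v" "length v = Suc (length p + k)" by auto
    then obtain a w where aw: "v = a # w" by (cases v) auto
    have "w \<in> S" using v(1) factorial_appendD2[OF assms(3), of "[a]" w] aw by simp
    \<comment> \<open>\<open>v\<close> is longer than \<open>p\<close>, so the suffix
      \<open>p\<close> does not reach the first letter.\<close>
    moreover have "suffix p w" using v aw by (auto simp: suffix_Cons)
    moreover have "a \<in> A" using v(1) aw assms(2) by auto
    ultimately have "(w, a) \<in> (SIGMA w:?W k. left_ext A S w)"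
      using v aw by (auto simp: left_ext_def)
    then show "v \<in> ?g ` (SIGMA w:?W k. left_ext A S w)" using aw by force
  qed (auto simp: left_ext_def suffix_Cons)
  moreover have "inj_on ?g (SIGMA w:?W k. left_ext A S w)" by (auto simp: inj_on_def)
  ultimately have "(\<Sum>v\<in>?W (Suc k). f v) = (\<Sum>s\<in>(SIGMA w:?W k. left_ext A S w). f (?g s))"
    by (metis (no_types, lifting) sum.reindex_cong)
  also have "\<dots> = (\<Sum>w\<in>?W k. \<Sum>a\<in>left_ext A S w. f (a # w))"
    using fin assms(1) by (subst sum.Sigma) (auto simp: left_ext_def case_prod_unfold)
  also have "\<dots> = (\<Sum>w\<in>?W k. f w)"
    using assms(4) unfolding left_harmonic_def by (intro sum.cong) auto
  finally show ?case using Suc by simp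
qed

text \<open>Each \<open>f p\<close> is spread over the words of length \<open>M\<close>. After the
  sums are swapped, every such word is weighted by its \<open>n\<close> suffixes in
  \<open>P\<close>; spreading \<open>f []\<close> in the same way identifies the total.\<close>

lemma left_harmonic_sum_suffixes:
  assumes "finite A" "S \<subseteq> lists A" "factorial S" "left_harmonic A S f"
    and "P \<subseteq> S" "finite P" "[] \<in> S" "\<And>p. p \<in> P \<Longrightarrow> length p \<le> M"
    and n: "\<And>w. w \<in> S \<Longrightarrow> length w = M \<Longrightarrow> card {p\<in>P. suffix p w} = n"
  shows "(\<Sum>p\<in>P. f p) = int n * f []"
proof -
  let ?W = "{w\<in>S. length w = M}"
  have fin: "finite ?W" by (rule finite_words_of_length[OF assms(1,2)])
  have harm: "f p = (\<Sum>w\<in>?W. if suffix p w then f w else 0)" if "p \<in> S" "length p \<le> M" for p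
  proof -
    have "{w\<in>S. suffix p w \<and> length w = length p + (M - length p)} = {w\<in>?W. suffix p w}"
      using that by auto
    then have "f p = (\<Sum>w\<in>{w\<in>?W. suffix p w}. f w)"
      using left_harmonic_sum[OF assms(1-4) that(1), of "M - length p"] by metis
    also have "\<dots> = (\<Sum>w\<in>?W. if suffix p w then f w else 0)"
      using fin by (rule sum.inter_filter)
    finally show ?thesis .
  qed
  have "(\<Sum>p\<in>P. f p) = (\<Sum>p\<in>P. \<Sum>w\<in>?W. if suffix p w then f w else 0)"
    using assms(5,8) by (intro sum.cong harm) auto
  also have "\<dots> = (\<Sum>w\<in>?W. \<Sum>p\<in>P. if suffix p w then f w else 0)"
    by (rule sum.swap)
  also have "\<dots> = (\<Sum>w\<in>?W. int n * f w)"
  proof (rule sum.cong[OF refl])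
    fix w assume "w \<in> ?W"
    then show "(\<Sum>p\<in>P. if suffix p w then f w else 0) = int n * f w"
      using n[of w] assms(6) by (simp add: sum.inter_filter[symmetric])
  qed
  also have "\<dots> = int n * f []"
    using harm[of "[]"] assms(7) by (simp add: sum_distrib_left)
  finally show ?thesis .
qed

section \<open>Neutrality as left-harmonicity\<close>

lemma sum_right_ext_eq_two_sided_ext:
  assumes "finite A" "factorial S"
  shows "(\<Sum>a\<in>left_ext A S w. card (right_ext A S (a # w))) = card (two_sided_ext A S w)"
proof -
  have "two_sided_ext A S w = (SIGMA a:left_ext A S w. right_ext A S (a # w))"
    using factorial_appendD1[OF assms(2), of "_ # w"]
    by (fastforce simp: two_sided_ext_def left_ext_def right_ext_def)
  then show ?thesis
    using assms(1) by (simp add: left_ext_def right_ext_def)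
qed

text \<open>The value at the empty word is shifted to absorb its possible lack of neutrality.\<close>

lemma neutral_set_left_harmonic:
  assumes "finite A" "neutral_set A S" "\<forall>a\<in>A. [a] \<in> S"
  shows "left_harmonic A S
    (\<lambda>w. if w = [] then int (card A) - characteristic A S else int (card (right_ext A S w)) - 1)"
  unfolding left_harmonic_def
proof
  fix w assume "w \<in> S"
  have fac: "factorial S" using assms(2) by (simp add: neutral_set_def)
  have "right_ext A S [] = A" using assms(3) by (auto simp: right_ext_def)
  moreover have "w \<noteq> [] \<Longrightarrow> multiplicity A S w = 0"
    using assms(2) \<open>w \<in> S\<close> by (auto simp: neutral_set_def neutral_word_def)
  moreover have "(\<Sum>a\<in>left_ext A S w. int (card (right_ext A S (a # w)))) =
      int (card (two_sided_ext A S w))"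
    using sum_right_ext_eq_two_sided_ext[OF assms(1) fac, of w] by (metis of_nat_sum)
  \<comment> \<open>In the usual notation the right side is e - l = m + r - 1. This is r - 1 for
    nonempty \<open>w\<close>, where m = 0; for empty \<open>w\<close>, m is
    \<open>1 - characteristic A S\<close> and r is \<open>card A\<close>.\<close>
  ultimately show "(if w = [] then int (card A) - characteristic A S
        else int (card (right_ext A S w)) - 1) =
      (\<Sum>a\<in>left_ext A S w. if a # w = [] then int (card A) - characteristic A S
        else int (card (right_ext A S (a # w))) - 1)"
    by (auto simp: sum_subtractf multiplicity_def characteristic_def)
qed

theorem theorem2:
  fixes A :: "'a set" and S X :: "'a list set" and n :: nat
  assumes "finite A"
    and "S \<subseteq> lists A"
    and "recurrent S"
    and "neutral_set A S"
    and "\<forall>a\<in>A. [a] \<in> S"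
    and "finite X"
    and "maximal_bifix_code S X"
    and "S_degree A S X = n"
  shows "int (card X) = int n * (int (card A) - characteristic A S) + characteristic A S"
proof (cases "S = {}")
  case True
  \<comment> \<open>Here \<open>S_degree\<close> is the unspecified \<open>Max {}\<close>, but its coefficient vanishes.\<close>
  then have "A = {}" "X = {}"
    using assms(5,7) by (auto simp: maximal_bifix_code_def)
  moreover have "characteristic A S = 0"
    using True by (simp add: characteristic_def multiplicity_def two_sided_ext_def
        left_ext_def right_ext_def)
  ultimately show ?thesis by simp
next
  case False
  have fac: "factorial S" using assms(3) by (simp add: recurrent_def)
  have bif: "bifix_code X" and pre: "prefix_code X" and XS: "X \<subseteq> S"
    using assms(7) by (auto simp: maximal_bifix_code_def bifix_code_def)
  note complete = maximal_bifix_code_complete[OF assms(3,6,7)]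
  have "[] \<in> S" using False fac factorial_appendD1[of S "[]"] by auto
  then have "X \<noteq> {}" using complete(1) by (auto simp: prefix_complete_def)
  define P where "P = {p. \<exists>x\<in>X. strict_prefix p x}"
  define f where "f w = (if w = [] then int (card A) - characteristic A S
    else int (card (right_ext A S w)) - 1)" for w
  have "finite P" unfolding P_def by (rule finite_proper_prefixes[OF assms(6)])
  have "[] \<in> P" using \<open>X \<noteq> {}\<close> pre unfolding P_def prefix_code_def by (auto simp: strict_prefix_def)
  have PS: "P \<subseteq> S"
    using XS factorial_appendD1[OF fac] unfolding P_def by (fastforce simp: strict_prefix_def prefix_def)
  \<comment> \<open>Length \<open>M\<close> suffices both for spreading the values on
    \<open>P\<close> and for the parse count to be \<open>n\<close>.\<close>
  define M where "M = Max (length ` X)"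
  have M: "length x \<le> M" if "x \<in> X" for x
    using that assms(6) unfolding M_def by simp
  have "(\<Sum>p\<in>P. f p) = int n * f []"
  proof (rule left_harmonic_sum_suffixes[OF assms(1,2) fac _ PS \<open>finite P\<close> \<open>[] \<in> S\<close>])
    show "left_harmonic A S f"
      unfolding f_def by (rule neutral_set_left_harmonic[OF assms(1,4,5)])
    show "length p \<le> M" if "p \<in> P" for p
      using that M unfolding P_def by (fastforce simp: strict_prefix_def dest: prefix_length_le)
    show "card {p\<in>P. suffix p w} = n" if "w \<in> S" "length w = M" for w
    proof -
      have "\<not> prefix x p" if "p \<in> P" "x \<in> X" for p x
        using that pre unfolding P_def prefix_code_def by (auto dest: prefix_order.le_less_trans)
      then have "{p\<in>P. suffix p w} = suffix_parses X w"
        using suffix_parses_subset[OF fac complete(1) that(1)]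
        unfolding P_def[symmetric] by (auto simp: suffix_parses_def)
      then show ?thesis
        using parse_count_long_word[OF assms(3,2) bif assms(6) complete that(1)] M that(2) assms(8)
        by simp
    qed
  qed
  moreover have "right_ext A S [] = A" using assms(5) by (auto simp: right_ext_def)
  \<comment> \<open>The root is split off: only there can \<open>f p\<close> differ from
    \<open>int (card (right_ext A S p)) - 1\<close>. The difference
    \<open>characteristic A S - 1\<close>, plus the 1 of the tree count, is the additive constant of
    the formula.\<close>
  moreover have "(\<Sum>p\<in>P. g p) = g [] + (\<Sum>p\<in>P - {[]}. g p)" for g :: "'a list \<Rightarrow> int"
    using \<open>finite P\<close> \<open>[] \<in> P\<close> by (rule sum.remove)
  moreover have "(\<Sum>p\<in>P - {[]}. f p) = (\<Sum>p\<in>P - {[]}. int (card (right_ext A S p)) - 1)"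
    by (rule sum.cong) (auto simp: f_def)
  moreover have "int (card X) = 1 + (\<Sum>p\<in>P. int (card (right_ext A S p)) - 1)"
    using card_prefix_tree[OF assms(1,2) fac assms(6) \<open>X \<noteq> {}\<close> XS pre complete(1)]
    unfolding P_def .
  ultimately show ?thesis by (simp add: f_def)
qed

end
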